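(* Let $(X,d,\nu)$ be a measured length space satisfying the $BBL(0,N)$ condition for a certain $N>0$. Let $x_0\in X$ and $0<r_1\leq r_2$. Then $$\nu(B_{r_2}(x_0))\leq\left(\frac{r_2}{r_1}\right)^N\nu(B_{r_1}(x_0)).$$
   Context: A length space is a metric space $(X,d)$ in which the distance between two points is the infimum of the lengths of curves joining them. A measured length space $(X,d,\nu)$ is a length space with a Borel probability measure $\nu$. $B_r(x_0)=\{x\in X: d(x,x_0)\leq r\}$. For $x,y\in X$ and $t\in[0,1]$, $Z_t(x,y)$ is the set of $z\in X$ with $d(x,z)=t\,d(x,y)$ and $d(z,y)=(1-t)\,d(x,y)$. For $p\in\mathbb{R}\setminus\{0\}$, $t\in[0,1]$ and $a,b\geq 0$, the $p$-mean is $\mathcal{M}_t^p(a,b):=((1-t)a^p+tb^p)^{1/p}$ if $ab\neq0$ and $\mathcal{M}_t^p(a,b):=0$ if $ab=0$. For $p=0$, $\mathcal{M}_t^0(a,b):=a^{1-t}b^t$ if $ab\neq 0$ and $0$ if $ab=0$. Also $\mathcal{M}_t^{-\infty}(a,b):=\min(a,b)$. For real $N>0$ and $p\geq-1/N$, $(X,d,\nu)$ satisfies $BBL_p(0,N)$ if for every $t\in[0,1]$ and every triple of ($\nu$-integrable) functions $f,g,h:X\to\mathbb{R}_+$ satisfying $h(z)\geq\mathcal{M}_t^p(f(x),g(y))$ for all $x,y\in X$ and $z\in Z_t(x,y)$, one has $$\int_X h\,d\nu\geq\mathcal{M}_t^{p/(1+Np)}\left(\int_X f\,d\nu,\int_X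 g\,d\nu\right),$$ where for $p=-1/N$ the exponent $p/(1+Np)$ is understood as $-\infty$. $(X,d,\nu)$ satisfies $BBL(0,N)$ if it satisfies $BBL_p(0,N)$ for every $p\geq-1/N$.
   Formalization: The point x_0 is additionally assumed to lie in the support of ν (every open neighbourhood has positive measure); otherwise the claim fails, e.g. for the Dirac measure at 1 on the real line with x_0 = 0, r_1 = 1/2, r_2 = 1. *)

theory Defs
  imports "HOL-Probability.Probability"
begin

definition curve_length :: "(real \<Rightarrow> 'a::metric_space) \<Rightarrow> ennreal" where
  "curve_length \<gamma> =
     (SUP (n, s) \<in> {(n::nat, s::nat \<Rightarrow> real). mono_on {..n} s \<and> s ` {..n} \<subseteq> {0..1}}.
        \<Sum>i<n. ennreal (dist (\<gamma> (s i)) (\<gamma> (s (Suc i)))))"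

text \<open>The metric space is the whole type. The infimum is taken in \<^typ>\<open>ennreal\<close>, where the
  infimum over the empty set is infinite; hence in a length space any two points are joined by
  curves of finite length.\<close>

definition length_space :: "'a::metric_space itself \<Rightarrow> bool" where
  "length_space (T :: 'a itself) \<longleftrightarrow>
     (\<forall>x y :: 'a. ennreal (dist x y) =
        (INF \<gamma> \<in> {\<gamma>. path \<gamma> \<and> pathstart \<gamma> = x \<and> pathfinish \<gamma> = y}. curve_length \<gamma>))"

definition measured_length_space :: "'a::metric_space measure \<Rightarrow> bool" where
  "measured_length_space (\<nu> :: 'a measure) \<longleftrightarrow>
     length_space TYPE('a) \<and> sets \<nu> = sets borel \<and> prob_space \<nu>"

text \<open>The Bishop--Gromov estimate is stated at points of the support: with the convention that a mean
  with a zero argument is \<open>0\<close>, a Dirac measure satisfies the \<open>BBL\<close> condition for every \<open>N > 0\<close>, and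
  the estimate fails for it around any other point.\<close>

definition measure_supp :: "'a::topological_space measure \<Rightarrow> 'a set" where
  "measure_supp \<nu> = {x. \<forall>U. open U \<and> x \<in> U \<longrightarrow> emeasure \<nu> U > 0}"

definition intermediate_points :: "real \<Rightarrow> 'a::metric_space \<Rightarrow> 'a \<Rightarrow> 'a set" where
  "intermediate_points t x y =
     {z. dist x z = t * dist x y \<and> dist z y = (1 - t) * dist x y}"

definition p_mean :: "real \<Rightarrow> real \<Rightarrow> real \<Rightarrow> real \<Rightarrow> real" where
  "p_mean p t a b =
     (if a * b = 0 then 0
      else if p = 0 then a powr (1 - t) * b powr t
      else ((1 - t) * a powr p + t * b powr p) powr (1 / p))"

text \<open>The mean of exponent \<open>p / (1 + N * p)\<close>. For \<open>p = - 1 / N\<close> the denominator vanishes and the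
  exponent is read as minus infinity, whose mean is the minimum (HOL division by zero would give
  the exponent \<open>0\<close> instead).\<close>

definition bbl_mean :: "real \<Rightarrow> real \<Rightarrow> real \<Rightarrow> real \<Rightarrow> real \<Rightarrow> real" where
  "bbl_mean N p t a b = (if p = - 1 / N then min a b else p_mean (p / (1 + N * p)) t a b)"

definition BBL_p :: "real \<Rightarrow> real \<Rightarrow> 'a::metric_space measure \<Rightarrow> bool" where
  "BBL_p p N \<nu> \<longleftrightarrow>
     (\<forall>t\<in>{0..1}. \<forall>f g h :: 'a \<Rightarrow> real.
        integrable \<nu> f \<and> integrable \<nu> g \<and> integrable \<nu> h \<and>
        (\<forall>x. f x \<ge> 0) \<and> (\<forall>x. g x \<ge> 0) \<and> (\<forall>x. h x \<ge> 0) \<and>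
        (\<forall>x y. \<forall>z\<in>intermediate_points t x y. h z \<ge> p_mean p t (f x) (g y)) \<longrightarrow>
        (\<integral>x. h x \<partial>\<nu>) \<ge> bbl_mean N p t (\<integral>x. f x \<partial>\<nu>) (\<integral>x. g x \<partial>\<nu>))"

definition BBL :: "real \<Rightarrow> 'a::metric_space measure \<Rightarrow> bool" where
  "BBL N \<nu> \<longleftrightarrow> (\<forall>p \<ge> - 1 / N. BBL_p p N \<nu>)"

end

theory Submission
  imports Defs
begin

text \<open>
  Write \<open>t = r1 / r2\<close>. A point dividing a segment from \<open>x\<close> to \<open>y\<close> in the ratio \<open>t\<close>, with \<open>x\<close>
  near \<open>x0\<close> and \<open>y\<close> in the ball of radius \<open>r2\<close>, lies near the ball of radius \<open>t * r2 = r1\<close>. So the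
  Brunn--Minkowski inequality, which is the case of indicator functions, bounds the measure of a
  slight thickening of the small ball from below by a mean of the measures of a tiny ball around
  \<open>x0\<close> and of the large ball. The tiny ball has positive measure because \<open>x0\<close> lies in the support,
  so it keeps the mean from vanishing; its size is irrelevant, as the mean of exponent
  \<open>q = p / (1 + N * p) > 0\<close> is at least \<open>t powr (1 / q)\<close> times its second argument.

  Here \<open>1 / q = N + 1 / p\<close>. A mean of \<open>1\<close> and \<open>1\<close> is \<open>1\<close> for every \<open>p\<close>, so \<open>p\<close> may be sent to
  infinity, giving the sharp exponent \<open>N\<close>, while the thickening shrinks to the closed ball of
  radius \<open>r1\<close>, whose measure is the limit by continuity from above.
\<close>

lemma intermediate_points_cball:
  fixes x0 :: "'a::metric_space"
  assumes "0 \<le> t" "t \<le> 1" "x \<in> cball x0 e" "y \<in> cball x0 r" "z \<in> intermediate_points t x y"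
  shows "z \<in> cball x0 (t * r + 2 * e)"
proof -
  have e: "dist x0 x \<le> e" "dist x y \<le> e + r"
    using assms(3,4) dist_triangle[of x y x0] by (auto simp: dist_commute)
  have "t * dist x y \<le> t * (e + r)"
    using e(2) assms(1) by (rule mult_left_mono)
  moreover have "t * e \<le> e"
    using assms(1,2) order_trans[OF zero_le_dist e(1)] by (intro mult_left_le_one_le)
  moreover have "dist x0 z \<le> dist x0 x + t * dist x y"
    using dist_triangle[of x0 z x] assms(5) by (simp add: intermediate_points_def)
  ultimately show ?thesis
    using e(1) by (simp add: distrib_left)
qed

lemma p_mean_one_one: "p_mean p t 1 1 = 1"
  by (simp add: p_mean_def)

lemma p_mean_ge_right:
  assumes "0 < q" "0 < t" "t \<le> 1" "0 < a" "0 \<le> b"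
  shows "t powr (1 / q) * b \<le> p_mean q t a b"
proof (cases "b = 0")
  case False
  have "t powr (1 / q) * b = (t * b powr q) powr (1 / q)"
    using assms False by (simp add: powr_mult powr_powr)
  also have "\<dots> \<le> ((1 - t) * a powr q + t * b powr q) powr (1 / q)"
    using assms by (intro powr_mono2) auto
  finally show ?thesis
    using assms False by (simp add: p_mean_def)
qed (simp add: p_mean_def)

text \<open>The inequality for indicator functions turns the functional condition into a statement about
  sets; \<open>C\<close> is given from outside because the set of all intermediate points need not be
  measurable.\<close>

lemma BBL_p_sets:
  fixes \<nu> :: "'a::metric_space measure"
  assumes "finite_measure \<nu>" "BBL_p p N \<nu>" "0 \<le> t" "t \<le> 1"
    and "A \<in> sets \<nu>" "B \<in> sets \<nu>" "C \<in> sets \<nu>"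
    and "\<And>x y z. x \<in> A \<Longrightarrow> y \<in> B \<Longrightarrow> z \<in> intermediate_points t x y \<Longrightarrow> z \<in> C"
  shows "bbl_mean N p t (measure \<nu> A) (measure \<nu> B) \<le> measure \<nu> C"
proof -
  interpret finite_measure \<nu> by fact
  have integrable: "integrable \<nu> (indicat_real S)" if "S \<in> sets \<nu>" for S
    using that by (simp add: emeasure_eq_measure)
  have integral: "(\<integral>x. indicat_real S x \<partial>\<nu>) = measure \<nu> S" if "S \<in> sets \<nu>" for S
    using that by (metis Bochner_Integration.integral_indicator sets.Int_space_eq2)
  have "p_mean p t (indicator A x) (indicator B y) \<le> indicat_real C z"
    if "z \<in> intermediate_points t x y" for x y z
  proof (cases "x \<in> A \<and> y \<in> B")
    case True
    then have "z \<in> C"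
      using assms(8) that by blast
    with True show ?thesis
      by (simp add: p_mean_one_one)
  next
    case False
    then show ?thesis
      by (auto simp: p_mean_def indicator_def)
  qed
  then have "bbl_mean N p t (\<integral>x. indicator A x \<partial>\<nu>) (\<integral>x. indicator B x \<partial>\<nu>)
      \<le> (\<integral>x. indicator C x \<partial>\<nu>)"
    using assms(3-7) integrable by (intro assms(2)[unfolded BBL_p_def, rule_format]) auto
  then show ?thesis
    using assms(5-7) integral by simp
qed

lemma BBL_p_cball:
  fixes \<nu> :: "'a::metric_space measure"
  assumes "finite_measure \<nu>" "sets \<nu> = sets borel" "BBL_p p N \<nu>" "0 < N" "0 < p"
    and "x0 \<in> measure_supp \<nu>" "0 < t" "t \<le> 1" "0 < e"
  shows "t powr (N + 1 / p) * measure \<nu> (cball x0 r) \<le> measure \<nu> (cball x0 (t * r + 2 * e))"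
proof -
  interpret finite_measure \<nu> by fact
  let ?q = "p / (1 + N * p)"
  have q: "0 < ?q" "1 / ?q = N + 1 / p"
    using assms(4,5) by (simp_all add: field_simps pos_add_strict)
  have "- 1 / N < 0"
    using assms(4) by simp
  then have p: "p \<noteq> - 1 / N"
    using assms(5) by linarith
  have "0 < emeasure \<nu> (ball x0 e)"
    using assms(6,9) by (simp add: measure_supp_def)
  also have "\<dots> \<le> emeasure \<nu> (cball x0 e)"
    using assms(2) by (intro emeasure_mono) auto
  finally have "0 < measure \<nu> (cball x0 e)"
    by (simp add: emeasure_eq_measure)
  then have "t powr (1 / ?q) * measure \<nu> (cball x0 r)
      \<le> bbl_mean N p t (measure \<nu> (cball x0 e)) (measure \<nu> (cball x0 r))"
    unfolding bbl_mean_def if_not_P[OF p] using q(1) assms(7,8) by (intro p_mean_ge_right) auto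
  also have "\<dots> \<le> measure \<nu> (cball x0 (t * r + 2 * e))"
    using assms by (intro BBL_p_sets) (auto intro: intermediate_points_cball simp del: mem_cball)
  finally show ?thesis
    unfolding q(2) .
qed

lemma measure_cball_tendsto_from_above:
  fixes \<nu> :: "'a::metric_space measure"
  assumes "finite_measure \<nu>" "sets \<nu> = sets borel" "decseq e" "e \<longlonglongrightarrow> 0"
  shows "(\<lambda>n. measure \<nu> (cball x0 (r + e n))) \<longlonglongrightarrow> measure \<nu> (cball x0 r)"
proof -
  interpret finite_measure \<nu> by fact
  have "(\<Inter>n. cball x0 (r + e n)) = cball x0 r"
  proof (intro equalityI subsetI)
    fix x assume "x \<in> (\<Inter>n. cball x0 (r + e n))"
    then have "\<And>n. dist x0 x \<le> r + e n"
      by auto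
    moreover have "(\<lambda>n. r + e n) \<longlonglongrightarrow> r"
      using tendsto_add[OF tendsto_const assms(4), of r] by simp
    ultimately show "x \<in> cball x0 r"
      using LIMSEQ_le_const[of _ r "dist x0 x"] by auto
  next
    fix x assume "x \<in> cball x0 r"
    then show "x \<in> (\<Inter>n. cball x0 (r + e n))"
      using decseq_ge[OF assms(3,4)] by (auto intro: order_trans)
  qed
  moreover have "decseq (\<lambda>n. cball x0 (r + e n))"
    using assms(3) by (intro antimonoI) (auto simp: subset_cball dest: decseqD)
  moreover have "range (\<lambda>n. cball x0 (r + e n)) \<subseteq> sets \<nu>"
    unfolding assms(2) by auto
  ultimately show ?thesis
    using finite_Lim_measure_decseq[of "\<lambda>n. cball x0 (r + e n)"] by simp
qed

theorem theorem3p4: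
  fixes \<nu> :: "'a::metric_space measure"
    and N r1 r2 :: real
    and x0 :: 'a
  assumes "measured_length_space \<nu>"
    and "N > 0"
    and "BBL N \<nu>"
    and "x0 \<in> measure_supp \<nu>"
    and "0 < r1" and "r1 \<le> r2"
  shows "measure \<nu> (cball x0 r2) \<le> (r2 / r1) powr N * measure \<nu> (cball x0 r1)"
proof -
  have borel: "sets \<nu> = sets borel" and "prob_space \<nu>"
    using assms(1) by (auto simp: measured_length_space_def)
  then have fin: "finite_measure \<nu>"
    by (simp add: prob_space_def)
  define t where "t = r1 / r2"
  have t: "0 < t" "t \<le> 1" "t * r2 = r1"
    using assms(5,6) by (auto simp: t_def)
  define d where "d n = inverse (real (Suc n))" for n
  have d0: "d \<longlonglongrightarrow> 0"
    unfolding d_def by (rule LIMSEQ_inverse_real_of_nat)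
  \<comment> \<open>The thickness \<open>d n\<close> of the small ball and the exponent \<open>p = 1 / d n\<close> go to their limits
    together.\<close>
  have bound: "t powr (N + d n) * measure \<nu> (cball x0 r2) \<le> measure \<nu> (cball x0 (r1 + 2 * d n))" for n
  proof -
    have "- 1 / N < 0"
      using assms(2) by simp
    moreover have d: "0 < d n"
      by (simp add: d_def)
    then have "0 < 1 / d n"
      by simp
    ultimately have "BBL_p (1 / d n) N \<nu>"
      using assms(3) unfolding BBL_def by (meson less_imp_le less_trans)
    from BBL_p_cball[OF fin borel this assms(2) \<open>0 < 1 / d n\<close> assms(4) t(1,2) d, of r2]
    show ?thesis
      by (simp add: t(3))
  qed
  have lhs: "(\<lambda>n. t powr (N + d n) * measure \<nu> (cball x0 r2))
      \<longlonglongrightarrow> t powr (N + 0) * measure \<nu> (cball x0 r2)"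
    using t(1) d0 by (intro tendsto_intros) auto
  have "decseq (\<lambda>n. 2 * d n)"
    by (intro antimonoI) (simp add: d_def field_simps)
  moreover have "(\<lambda>n. 2 * d n) \<longlonglongrightarrow> 0"
    using tendsto_mult_right_zero[OF d0] by simp
  ultimately have "t powr (N + 0) * measure \<nu> (cball x0 r2) \<le> measure \<nu> (cball x0 r1)"
    using bound
    by (intro LIMSEQ_le[OF lhs measure_cball_tendsto_from_above[OF fin borel, of "\<lambda>n. 2 * d n"]]) auto
  then have "(r2 / r1) powr N * (t powr N * measure \<nu> (cball x0 r2))
      \<le> (r2 / r1) powr N * measure \<nu> (cball x0 r1)"
    by (intro mult_left_mono) auto
  moreover have "(r2 / r1) powr N * t powr N = 1"
    using assms(5,6) by (simp add: t_def flip: powr_mult)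
  ultimately show ?thesis
    by (simp flip: mult.assoc)
qed

end
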